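(* Let $0 < k \leq \ell$ be two natural numbers. Then there exist GSP graphs $A_{k,\ell}$ such that $c_{\mathbf{coUNIP}}(A_{k,\ell}) = \min\{k, \log \ell\}$.
   Context: Logarithms are to base 2. For a class of graphs $\mathcal{P}$, a covering of a graph $G$ by graphs of class $\mathcal{P}$ is an expression $E(G) = E(G_1) \cup \dots \cup E(G_m)$ of the edge set of $G$ as the union of the edge sets of graphs $G_1, \dots, G_m$ with $G_i \in \mathcal{P}$ for all $i \in \{1, \dots, m\}$. The cover number $c_{\mathcal{P}}(G)$ is the smallest $m$ such that $G$ admits a covering by $m$ graphs of class $\mathcal{P}$. A graph $G$ is unipolar if $V(G)$ is a disjoint union $V(A) \cup V(B)$ such that $A$ is a clique and $B$ is a disjoint union of cliques ($A$ and $B$ being the subgraphs of $G$ induced by the two parts). A graph is co-unipolar if its complement is unipolar, and generalized split (GSP) if it is unipolar or co-unipolar. $c_{\mathbf{coUNIP}}$ denotes the cover number by co-unipolar graphs.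
   Formalization: The value log l is replaced by its ceiling ⌈log l⌉, since cover numbers are integers and the printed equation fails e.g. for k = 2, l = 3; whenever min{k, log l} is an integer the two formulas agree. *)

theory Defs
  imports Complex_Main "HOL-Library.Ramsey" "HOL-Library.Disjoint_Sets" "HOL-Library.Extended_Nat"
begin

type_synonym 'a graph = "'a set \<times> 'a set set"

abbreviation verts :: "'a graph \<Rightarrow> 'a set" where
  "verts \<equiv> fst"

abbreviation edges :: "'a graph \<Rightarrow> 'a set set" where
  "edges \<equiv> snd"

definition simple_graph :: "'a graph \<Rightarrow> bool" where
  "simple_graph G \<longleftrightarrow> finite (verts G) \<and> edges G \<subseteq> nsets (verts G) 2"

definition complement :: "'a graph \<Rightarrow> 'a graph" where
  "complement G = (verts G, nsets (verts G) 2 - edges G)"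

definition induced :: "'a graph \<Rightarrow> 'a set \<Rightarrow> 'a graph" where
  "induced G S = (verts G \<inter> S, edges G \<inter> nsets S 2)"

definition is_clique :: "'a graph \<Rightarrow> bool" where
  "is_clique G \<longleftrightarrow> clique (verts G) (edges G)"

(* The cells of the partition are the vertex sets of the cliques; nsets C 2 is the edge set
   of the complete graph on C. *)
definition disjoint_union_of_cliques :: "'a graph \<Rightarrow> bool" where
  "disjoint_union_of_cliques G \<longleftrightarrow>
     (\<exists>P. partition_on (verts G) P \<and> edges G = (\<Union>C\<in>P. nsets C 2))"

(* Either part may be empty. *)
definition unipolar :: "'a graph \<Rightarrow> bool" where
  "unipolar G \<longleftrightarrow>
     (\<exists>A B. A \<union> B = verts G \<and> A \<inter> B = {} \<and>
        is_clique (induced G A) \<and> disjoint_union_of_cliques (induced G B))"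

definition co_unipolar :: "'a graph \<Rightarrow> bool" where
  "co_unipolar G \<longleftrightarrow> unipolar (complement G)"

definition gsp :: "'a graph \<Rightarrow> bool" where
  "gsp G \<longleftrightarrow> unipolar G \<or> co_unipolar G"

(* Only the edge sets have to match: no condition relates the vertex sets of the members of the
   covering to that of G. The empty covering (m = 0) covers exactly the edgeless graphs. *)
definition covering :: "('a graph \<Rightarrow> bool) \<Rightarrow> 'a graph \<Rightarrow> 'a graph list \<Rightarrow> bool" where
  "covering P G Hs \<longleftrightarrow>
     (\<forall>H\<in>set Hs. simple_graph H \<and> P H) \<and> edges G = (\<Union>H\<in>set Hs. edges H)"

(* An infimum in enat, so that the value is \<infinity> if G admits no covering at all. *)
definition cover_number :: "('a graph \<Rightarrow> bool) \<Rightarrow> 'a graph \<Rightarrow> enat" where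
  "cover_number P G = (INF Hs\<in>{Hs. covering P G Hs}. enat (length Hs))"

end

theory Submission
  imports Defs "HOL-Library.Nat_Bijection"
begin

text \<open>
  The graph is the disjoint union of \<open>k\<close> cliques with \<open>l\<close> vertices each. It is unipolar, with an
  empty central clique. Two coverings by co-unipolar graphs suggest themselves: one member for each
  clique, which takes \<open>k\<close> members, and a covering by bipartite graphs, which takes
  \<open>\<lceil>log 2 l\<rceil>\<close> members, because the edges of a clique are covered by \<open>n\<close> bipartite graphs exactly if
  the \<open>2 ^ n\<close> vectors of colours suffice to tell its vertices apart.

  No covering can beat both, because every co-unipolar subgraph of the graph is of one of these two
  kinds (lemma \<open>co_unipolar_bipartite_or_within_block\<close>): the vertices of a co-unipolar graph split
  into an independent set \<open>A\<close> and a set \<open>B\<close> that induces a complete multipartite graph. If \<open>B\<close> has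
  at most one part, the graph is bipartite; otherwise \<open>B\<close> is connected, hence lies in a single clique,
  and every edge has an end in \<open>B\<close>. So a covering with fewer than \<open>k\<close> members leaves
  some clique to its bipartite members alone, and there are at least \<open>log 2 l\<close> of those
  (lemma \<open>covering_lower_bound\<close>).
\<close>

definition cliques_on :: "'a set set \<Rightarrow> 'a graph" where
  "cliques_on P = (\<Union>P, \<Union>C\<in>P. nsets C 2)"

text \<open>A loop \<open>{x, x}\<close> would need \<open>c x \<noteq> c x\<close>, so the colouring also excludes loops.\<close>

definition bipartite :: "'a graph \<Rightarrow> bool" where
  "bipartite G \<longleftrightarrow> (\<exists>c :: 'a \<Rightarrow> bool. \<forall>x y. {x, y} \<in> edges G \<longrightarrow> c x \<noteq> c y)"

lemma pair_in_nsets_2_iff: "{x, y} \<in> nsets C 2 \<longleftrightarrow> x \<in> C \<and> y \<in> C \<and> x \<noteq> y"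
  by (auto simp: nsets_def card_2_iff doubleton_eq_iff)

lemma nsets_2_pair:
  assumes "e \<in> nsets C 2"
  obtains x y where "e = {x, y}" "x \<in> C" "y \<in> C" "x \<noteq> y"
  using assms by (auto simp: nsets_def card_2_iff)

lemma simple_graph_cliques_on:
  assumes "finite (\<Union>P)"
  shows "simple_graph (cliques_on P)"
  using assms by (fastforce simp: simple_graph_def cliques_on_def nsets_def)

lemma pair_in_cliques_on_iff:
  "{x, y} \<in> edges (cliques_on P) \<longleftrightarrow> (\<exists>C\<in>P. x \<in> C \<and> y \<in> C) \<and> x \<noteq> y"
  by (auto simp: cliques_on_def pair_in_nsets_2_iff)

lemma unipolar_cliques_on:
  assumes "disjoint P" and "{} \<notin> P"
  shows "unipolar (cliques_on P)"
proof -
  have "(\<Union>C\<in>P. nsets C 2) \<inter> nsets (\<Union>P) 2 = (\<Union>C\<in>P. nsets C 2)"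
    by (auto simp: nsets_def)
  then have "disjoint_union_of_cliques (induced (cliques_on P) (\<Union>P))"
    using assms unfolding disjoint_union_of_cliques_def
    by (intro exI[of _ P]) (auto simp: induced_def cliques_on_def partition_on_def)
  moreover have "is_clique (induced (cliques_on P) {})"
    by (simp add: is_clique_def induced_def)
  ultimately show ?thesis
    unfolding unipolar_def by (intro exI[of _ "{}"] exI[of _ "\<Union>P"]) (simp add: cliques_on_def)
qed

section \<open>Co-unipolar graphs\<close>

text \<open>
  Complementation turns the clique of a unipolar graph into an independent set and the disjoint
  union of cliques into a complete multipartite graph, whose parts are the blocks of \<open>Q\<close>.
\<close>

lemma co_unipolarE:
  assumes "co_unipolar H"
  obtains A B Q where "A \<union> B = verts H" "A \<inter> B = {}" "partition_on B Q"
    and "\<And>x y. x \<in> A \<Longrightarrow> y \<in> A \<Longrightarrow> x \<noteq> y \<Longrightarrow> {x, y} \<notin> edges H"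
    and "\<And>x y. x \<in> B \<Longrightarrow> y \<in> B \<Longrightarrow> x \<noteq> y \<Longrightarrow> {x, y} \<in> edges H \<longleftrightarrow> \<not> (\<exists>C\<in>Q. x \<in> C \<and> y \<in> C)"
proof -
  obtain A B where AB: "A \<union> B = verts H" "A \<inter> B = {}"
    and A: "is_clique (induced (complement H) A)"
    and B: "disjoint_union_of_cliques (induced (complement H) B)"
    using assms by (auto simp: co_unipolar_def unipolar_def complement_def)
  have [simp]: "verts H \<inter> A = A" "verts H \<inter> B = B"
    using AB by auto
  obtain Q where Q: "partition_on B Q"
    and Qe: "(nsets (verts H) 2 - edges H) \<inter> nsets B 2 = (\<Union>C\<in>Q. nsets C 2)"
    using B by (auto simp: disjoint_union_of_cliques_def induced_def complement_def)
  show thesis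
  proof (rule that[OF AB Q])
    fix x y assume "x \<in> A" "y \<in> A" "x \<noteq> y"
    then show "{x, y} \<notin> edges H"
      using A by (auto simp: is_clique_def induced_def complement_def clique_def)
  next
    fix x y assume xy: "x \<in> B" "y \<in> B" "x \<noteq> y"
    then have "{x, y} \<in> (nsets (verts H) 2 - edges H) \<inter> nsets B 2 \<longleftrightarrow> {x, y} \<notin> edges H"
      using AB by (auto simp: pair_in_nsets_2_iff)
    then show "{x, y} \<in> edges H \<longleftrightarrow> \<not> (\<exists>C\<in>Q. x \<in> C \<and> y \<in> C)"
      unfolding Qe using xy by (auto simp: pair_in_nsets_2_iff)
  qed
qed

lemma co_unipolar_bipartite:
  assumes "bipartite H"
  shows "co_unipolar H"
proof -
  obtain c :: "'a \<Rightarrow> bool" where c: "\<And>x y. {x, y} \<in> edges H \<Longrightarrow> c x \<noteq> c y"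
    using assms by (auto simp: bipartite_def)
  define A where "A = {x \<in> verts H. c x}"
  define B where "B = {x \<in> verts H. \<not> c x}"
  have [simp]: "verts H \<inter> A = A" "verts H \<inter> B = B"
    by (auto simp: A_def B_def)
  have "is_clique (induced (complement H) A)"
    using c by (auto simp: is_clique_def induced_def complement_def clique_def pair_in_nsets_2_iff A_def)
  moreover have "disjoint_union_of_cliques (induced (complement H) B)"
  proof -
    have "(nsets (verts H) 2 - edges H) \<inter> nsets B 2 = nsets B 2"
      using c by (auto simp: B_def pair_in_nsets_2_iff elim!: nsets_2_pair)
    \<comment> \<open>The blocks of a partition are nonempty, so an empty colour class has no block at all.\<close>
    then show ?thesis
      unfolding disjoint_union_of_cliques_def
      by (intro exI[of _ "{B} - {{}}"])
        (auto simp: induced_def complement_def partition_on_def nsets_def disjoint_def)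
  qed
  moreover have "A \<union> B = verts (complement H)" "A \<inter> B = {}"
    by (auto simp: A_def B_def complement_def)
  ultimately show ?thesis
    unfolding co_unipolar_def unipolar_def by blast
qed

text \<open>A complete graph is complete multipartite, with singletons as its parts.\<close>

lemma co_unipolar_complete: "co_unipolar (C, nsets C 2)"
proof -
  have "disjoint_union_of_cliques (induced (complement (C, nsets C 2)) C)"
    unfolding disjoint_union_of_cliques_def
    by (intro exI[of _ "(\<lambda>x. {x}) ` C"])
      (auto simp: induced_def complement_def partition_on_def disjoint_def elim!: nsets_2_pair)
  moreover have "is_clique (induced (complement (C, nsets C 2)) {})"
    by (simp add: is_clique_def induced_def)
  ultimately show ?thesis
    unfolding co_unipolar_def unipolar_def
    by (intro exI[of _ "{}"] exI[of _ C]) (simp add: complement_def)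
qed

text \<open>
  Suppose that two vertices \<open>u\<close> and \<open>v\<close> of the complete multipartite side \<open>B\<close> are adjacent. They lie
  in different parts, so every further vertex of \<open>B\<close> is adjacent to one of them. This confines \<open>B\<close>,
  and then every edge, to the block of \<open>P\<close> that contains \<open>u\<close> and \<open>v\<close>. If there are no such
  vertices, both sides are independent.
\<close>

lemma co_unipolar_bipartite_or_within_block:
  assumes H: "simple_graph H" "co_unipolar H"
    and sub: "edges H \<subseteq> edges (cliques_on P)"
    and P: "disjoint P"
  shows "bipartite H \<or> (\<exists>C\<in>P. edges H \<subseteq> nsets C 2)"
proof -
  obtain A B Q where AB: "A \<union> B = verts H" "A \<inter> B = {}" and Q: "partition_on B Q"
    and A: "\<And>x y. x \<in> A \<Longrightarrow> y \<in> A \<Longrightarrow> x \<noteq> y \<Longrightarrow> {x, y} \<notin> edges H"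
    and B: "\<And>x y. x \<in> B \<Longrightarrow> y \<in> B \<Longrightarrow> x \<noteq> y \<Longrightarrow> {x, y} \<in> edges H \<longleftrightarrow> \<not> (\<exists>C\<in>Q. x \<in> C \<and> y \<in> C)"
    by (rule co_unipolarE[OF H(2)]) (rule that)
  have ends: "x \<in> verts H \<and> y \<in> verts H \<and> x \<noteq> y" if "{x, y} \<in> edges H" for x y
    using H(1) that by (metis pair_in_nsets_2_iff simple_graph_def subsetD)
  have same_block: "y \<in> C" if "{x, y} \<in> edges H" "x \<in> C" "C \<in> P" for x y C
  proof -
    have "{x, y} \<in> edges (cliques_on P)"
      using sub that(1) by blast
    then obtain D where "D \<in> P" "x \<in> D" "y \<in> D"
      by (auto simp: pair_in_cliques_on_iff)
    then show ?thesis
      using P that(2,3) by (auto dest: disjointD)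
  qed
  show ?thesis
  proof (cases "\<exists>u\<in>B. \<exists>v\<in>B. {u, v} \<in> edges H")
    case False
    then have "\<forall>x y. {x, y} \<in> edges H \<longrightarrow> (x \<in> A) \<noteq> (y \<in> A)"
      using A AB ends by blast
    then show ?thesis
      unfolding bipartite_def by (intro disjI1 exI[of _ "\<lambda>x. x \<in> A"])
  next
    case True
    then obtain u v where uv: "u \<in> B" "v \<in> B" "{u, v} \<in> edges H"
      by blast
    then have "{u, v} \<in> edges (cliques_on P)"
      using sub by blast
    then obtain C where C: "C \<in> P" "u \<in> C" "v \<in> C"
      by (auto simp: pair_in_cliques_on_iff)
    have BC: "w \<in> C" if "w \<in> B" for w
    proof (rule ccontr)
      assume w: "w \<notin> C"
      then have "{u, w} \<notin> edges H" "{v, w} \<notin> edges H" "u \<noteq> w" "v \<noteq> w"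
        using same_block C by auto
      then obtain U V where UV: "U \<in> Q" "u \<in> U" "w \<in> U" "V \<in> Q" "v \<in> V" "w \<in> V"
        using B[of u w] B[of v w] uv \<open>w \<in> B\<close> by blast
      then have "U = V"
        using partition_onD2[OF Q] by (auto dest: disjointD)
      then show False
        using B[of u v] UV uv ends by blast
    qed
    have "e \<in> nsets C 2" if "e \<in> edges H" for e
    proof -
      obtain x y where e: "e = {x, y}"
        using H(1) \<open>e \<in> edges H\<close> by (auto simp: simple_graph_def elim!: nsets_2_pair)
      then have xy: "{x, y} \<in> edges H" "{y, x} \<in> edges H"
        using that by (auto simp: insert_commute)
      then have "x \<in> C \<or> y \<in> C"
        using A AB BC ends by blast
      then have "x \<in> C \<and> y \<in> C"
        using same_block xy C by blast
      then show ?thesis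
        using e ends xy by (simp add: pair_in_nsets_2_iff)
    qed
    then show ?thesis
      using C by blast
  qed
qed

section \<open>Coverings of a disjoint union of cliques\<close>

text \<open>Two vertices with the same vector of colours are adjacent in none of the bipartite graphs.\<close>

lemma card_le_of_bipartite_cover:
  assumes bip: "\<And>H. H \<in> set Hs \<Longrightarrow> bipartite H"
    and cov: "nsets C 2 \<subseteq> (\<Union>H\<in>set Hs. edges H)"
  shows "card C \<le> 2 ^ length Hs"
proof -
  have "\<forall>H\<in>set Hs. \<exists>c :: 'a \<Rightarrow> bool. \<forall>x y. {x, y} \<in> edges H \<longrightarrow> c x \<noteq> c y"
    using bip by (simp add: bipartite_def)
  then obtain c :: "'a graph \<Rightarrow> 'a \<Rightarrow> bool"
    where c: "\<forall>H\<in>set Hs. \<forall>x y. {x, y} \<in> edges H \<longrightarrow> c H x \<noteq> c H y"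
    by (rule bchoice[THEN exE])
  let ?L = "{bs :: bool list. set bs \<subseteq> UNIV \<and> length bs = length Hs}"
  have "inj_on (\<lambda>x. map (\<lambda>H. c H x) Hs) C"
  proof (rule inj_onI, rule ccontr)
    fix x y assume "x \<in> C" "y \<in> C" "map (\<lambda>H. c H x) Hs = map (\<lambda>H. c H y) Hs" "x \<noteq> y"
    moreover from this have "{x, y} \<in> nsets C 2"
      by (simp add: pair_in_nsets_2_iff)
    then obtain H where "H \<in> set Hs" "{x, y} \<in> edges H"
      using cov by blast
    ultimately show False
      using c by auto
  qed
  moreover have "(\<lambda>x. map (\<lambda>H. c H x) Hs) ` C \<subseteq> ?L"
    by auto
  moreover have "finite ?L"
    by (rule finite_lists_length_eq) simp
  ultimately have "card C \<le> card ?L"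
    by (rule card_inj_on_le)
  also have "\<dots> = 2 ^ length Hs"
    by (subst card_lists_length_eq) auto
  finally show ?thesis .
qed

lemma covering_lower_bound:
  assumes P: "disjoint P" and l: "\<And>C. C \<in> P \<Longrightarrow> card C = l"
    and cov: "covering co_unipolar (cliques_on P) Hs"
  shows "card P \<le> length Hs \<or> l \<le> 2 ^ length Hs"
proof (rule disjCI)
  assume few: "\<not> l \<le> 2 ^ length Hs"
  have simple: "simple_graph H" "co_unipolar H" "edges H \<subseteq> edges (cliques_on P)"
    if "H \<in> set Hs" for H
    using cov that by (auto simp: covering_def)
  define Hs1 where "Hs1 = filter bipartite Hs"
  define Hs2 where "Hs2 = filter (\<lambda>H. \<not> bipartite H) Hs"
  have "\<forall>H\<in>set Hs2. \<exists>C\<in>P. edges H \<subseteq> nsets C 2"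
    using co_unipolar_bipartite_or_within_block simple P by (fastforce simp: Hs2_def)
  then obtain D where D: "\<And>H. H \<in> set Hs2 \<Longrightarrow> D H \<in> P \<and> edges H \<subseteq> nsets (D H) 2"
    by metis
  have "P \<subseteq> D ` set Hs2"
  proof (rule subsetI, rule ccontr)
    fix C assume C: "C \<in> P" "C \<notin> D ` set Hs2"
    have "nsets C 2 \<subseteq> (\<Union>H\<in>set Hs1. edges H)"
    proof
      fix e assume e: "e \<in> nsets C 2"
      then obtain x y where xy: "e = {x, y}" "x \<in> C" "y \<in> C"
        by (auto elim: nsets_2_pair)
      have "e \<in> edges (cliques_on P)"
        using e C by (auto simp: cliques_on_def)
      then obtain H where H: "H \<in> set Hs" "e \<in> edges H"
        using cov by (auto simp: covering_def)
      have "H \<notin> set Hs2"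
      proof
        assume H2: "H \<in> set Hs2"
        then have "x \<in> D H"
          using D H xy by (metis pair_in_nsets_2_iff subsetD)
        then show False
          using D[OF H2] H2 C P xy by (metis disjointD disjoint_iff imageI)
      qed
      then have "H \<in> set Hs1"
        using H by (simp add: Hs1_def Hs2_def)
      then show "e \<in> (\<Union>H\<in>set Hs1. edges H)"
        using H by blast
    qed
    then have "card C \<le> 2 ^ length Hs1"
      by (intro card_le_of_bipartite_cover) (auto simp: Hs1_def)
    also have "\<dots> \<le> 2 ^ length Hs"
      by (simp add: Hs1_def)
    finally show False
      using few l C by simp
  qed
  then have "card P \<le> card (set Hs2)"
    by (meson List.finite_set card_image_le card_mono finite_imageI le_trans)
  also have "\<dots> \<le> length Hs"
    by (metis Hs2_def card_length le_trans length_filter_le)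
  finally show "card P \<le> length Hs" .
qed

lemma covering_by_blocks:
  assumes "finite P" and "finite (\<Union>P)"
  shows "\<exists>Hs. covering co_unipolar (cliques_on P) Hs \<and> length Hs = card P"
proof -
  obtain Cs where Cs: "set Cs = P" "length Cs = card P"
    using assms(1) by (metis distinct_card finite_distinct_list)
  have "finite C" if "C \<in> P" for C
    using assms(2) that by (meson Union_upper finite_subset)
  then have "covering co_unipolar (cliques_on P) (map (\<lambda>C. (C, nsets C 2)) Cs)"
    using Cs by (auto simp: covering_def cliques_on_def simple_graph_def co_unipolar_complete)
  then show ?thesis
    using Cs by (metis length_map)
qed

text \<open>
  The vertices of each block receive distinct subsets of \<open>{..<n}\<close> as labels. The \<open>i\<close>-th bipartite graph
  consists of the edges with exactly one end whose label contains \<open>i\<close>.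
\<close>

lemma covering_by_bipartite:
  assumes fin: "finite (\<Union>P)" and P: "disjoint P" and n: "\<And>C. C \<in> P \<Longrightarrow> card C \<le> 2 ^ n"
  shows "\<exists>Hs. covering co_unipolar (cliques_on P) Hs \<and> length Hs = n"
proof -
  have "\<exists>g. inj_on g C \<and> g ` C \<subseteq> Pow {..<n}" if "C \<in> P" for C
  proof -
    have "finite C"
      using fin that by (meson Union_upper finite_subset)
    then show ?thesis
      using n[OF that] by (subst inj_on_iff_card_le) (simp_all add: card_Pow)
  qed
  then obtain g where g: "\<And>C. C \<in> P \<Longrightarrow> inj_on (g C) C \<and> g C ` C \<subseteq> Pow {..<n}"
    by metis
  define f where "f x = {i. \<exists>C\<in>P. x \<in> C \<and> i \<in> g C x}" for x
  have f: "f x = g C x" if "C \<in> P" "x \<in> C" for x C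
    using that P by (auto simp: f_def dest: disjointD)
  define H where "H i = (\<Union>P, {e \<in> edges (cliques_on P). \<forall>x y. e = {x, y} \<longrightarrow> (i \<in> f x) \<noteq> (i \<in> f y)})"
    for i
  have simple: "simple_graph (H i)" for i
    using simple_graph_cliques_on[OF fin] by (auto simp: H_def simple_graph_def cliques_on_def)
  have "bipartite (H i)" for i
    unfolding bipartite_def by (rule exI[of _ "\<lambda>x. i \<in> f x"]) (auto simp: H_def)
  then have co: "co_unipolar (H i)" for i
    by (rule co_unipolar_bipartite)
  have "edges (cliques_on P) \<subseteq> (\<Union>i<n. edges (H i))"
  proof
    fix e assume e: "e \<in> edges (cliques_on P)"
    then obtain C x y where C: "C \<in> P" and xy: "e = {x, y}" "x \<in> C" "y \<in> C" "x \<noteq> y"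
      by (auto simp: cliques_on_def elim: nsets_2_pair)
    have "f x \<noteq> f y"
      using g[OF C] xy f[OF C] by (auto dest: inj_onD)
    moreover have "f x \<subseteq> {..<n}" "f y \<subseteq> {..<n}"
      using g[OF C] xy f[OF C] by auto
    ultimately obtain i where i: "i < n" "(i \<in> f x) \<noteq> (i \<in> f y)"
      by blast
    then have "e \<in> edges (H i)"
      using e xy by (auto simp: H_def doubleton_eq_iff)
    then show "e \<in> (\<Union>i<n. edges (H i))"
      using i by blast
  qed
  then have "covering co_unipolar (cliques_on P) (map H [0..<n])"
    using simple co by (auto simp: covering_def H_def atLeast0LessThan)
  then show ?thesis
    by (metis diff_zero length_map length_upt)
qed

lemma nat_ceiling_log2_le_iff:
  assumes "0 < l"
  shows "nat \<lceil>log 2 (real l)\<rceil> \<le> n \<longleftrightarrow> l \<le> 2 ^ n"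
proof -
  have "nat \<lceil>log 2 (real l)\<rceil> \<le> n \<longleftrightarrow> log 2 (real l) \<le> real n"
    by (simp add: nat_le_iff ceiling_le_iff)
  also have "\<dots> \<longleftrightarrow> real l \<le> 2 ^ n"
    using assms by (simp add: log_le_iff powr_realpow)
  also have "\<dots> \<longleftrightarrow> l \<le> 2 ^ n"
    by (metis numeral_power_le_of_nat_cancel_iff of_nat_le_numeral_power_cancel_iff)
  finally show ?thesis .
qed

lemma cover_number_cliques_on:
  assumes "finite P" and P: "disjoint P" and "0 < l" and l: "\<And>C. C \<in> P \<Longrightarrow> card C = l"
  shows "cover_number co_unipolar (cliques_on P) = enat (min (card P) (nat \<lceil>log 2 (real l)\<rceil>))"
    (is "_ = enat ?m")
proof (rule antisym)
  have fin: "finite (\<Union>P)"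
    using assms by (metis card_gt_0_iff finite_Union)
  have "l \<le> 2 ^ nat \<lceil>log 2 (real l)\<rceil>"
    using nat_ceiling_log2_le_iff[OF \<open>0 < l\<close>] by blast
  then have "\<exists>Hs. covering co_unipolar (cliques_on P) Hs \<and> length Hs = ?m"
    using covering_by_blocks[OF \<open>finite P\<close> fin] covering_by_bipartite[OF fin P] l
    by (metis min_def)
  then show "cover_number co_unipolar (cliques_on P) \<le> enat ?m"
    unfolding cover_number_def by (metis INF_lower mem_Collect_eq)
  have "?m \<le> length Hs" if "covering co_unipolar (cliques_on P) Hs" for Hs
    using covering_lower_bound[OF P l that] nat_ceiling_log2_le_iff[OF \<open>0 < l\<close>]
    by (auto simp: min_le_iff_disj)
  then show "enat ?m \<le> cover_number co_unipolar (cliques_on P)"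
    unfolding cover_number_def by (intro INF_greatest) simp
qed

theorem theorem9:
  fixes k l :: nat
  assumes "0 < k" and "k \<le> l"
  shows "\<exists>A :: nat graph. simple_graph A \<and> gsp A \<and>
           cover_number co_unipolar A = enat (min k (nat \<lceil>log 2 (real l)\<rceil>))"
proof -
  have l: "0 < l"
    using assms by simp
  define C where "C i = (\<lambda>j. prod_encode (i, j)) ` {..<l}" for i
  have card: "card (C i) = l" for i
    unfolding C_def by (subst card_image) (auto simp: inj_on_def)
  then have nonempty: "C i \<noteq> {}" for i
    using l by (metis card.empty less_irrefl)
  have disj: "C i \<inter> C j = {}" if "i \<noteq> j" for i j
    using that by (auto simp: C_def)
  define P where "P = C ` {..<k}"
  have P: "finite P" "disjoint P" "{} \<notin> P" "\<And>D. D \<in> P \<Longrightarrow> card D = l"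
  proof -
    show "disjoint P"
    proof (rule disjointI)
      fix D D' assume "D \<in> P" "D' \<in> P" "D \<noteq> D'"
      then obtain i j where "D = C i" "D' = C j" "i \<noteq> j"
        by (auto simp: P_def)
      then show "D \<inter> D' = {}"
        by (simp add: disj)
    qed
  qed (use card nonempty in \<open>auto simp: P_def\<close>)
  have "inj_on C {..<k}"
  proof (rule inj_onI, rule ccontr)
    fix i j assume "C i = C j" "i \<noteq> j"
    then show False
      using disj[of i j] nonempty[of i] by simp
  qed
  then have "card P = k"
    by (simp add: P_def card_image)
  moreover have "simple_graph (cliques_on P)"
    by (intro simple_graph_cliques_on) (auto simp: P_def C_def)
  moreover have "gsp (cliques_on P)"
    using unipolar_cliques_on[OF P(2,3)] by (simp add: gsp_def)
  ultimately show ?thesis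
    using cover_number_cliques_on[OF P(1,2) l P(4)] by metis
qed

end
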